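(* For the random walk on $\mathbb{Z}_{c^{n-1}}$ determined by the sequence $\{c^{n-1}\}_{n\ge 1}$, where $c>1$ is an integer, $$t_{mix}(\epsilon)\le \kappa n\log\big((n-1)(c-1)\big)-\kappa n\log\big(\log(4\epsilon^2+1)\big),\qquad\text{where } \kappa=\frac{1}{1-\cos(\pi/c)}.$$
   Context: Put $G_n=c^{n-1}$. For fixed $n$, the random walk determined by the sequence is the Markov chain $(X_t)_{t\ge 0}$ on $\mathbb{Z}_{G_n}=\mathbb{Z}/G_n\mathbb{Z}$ with $X_0=0$ and $X_{t+1}\equiv X_t+z_t\pmod{G_n}$, where each $z_t$ is chosen uniformly at random (independently at each step) from $\{G_1,\dots,G_n\}=\{1,c,\dots,c^{n-1}\}$. Let $P_0^t$ be the distribution of $X_t$ and $\pi$ the uniform distribution on $\mathbb{Z}_{G_n}$, which is the stationary distribution. The total variation distance between probability distributions on a finite set $S$ is $\|\mu-\eta\|_{TV}=\frac12\sum_{x\in S}|\mu(x)-\eta(x)|$. The mixing time is $t_{mix}(\epsilon)=\min\{t:\|P_0^t-\pi\|_{TV}\le\epsilon\}$. Here $\log$ is the natural logarithm.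
   Formalization: Proved for n ≥ 2, ε > 0 with log(4ε²+1) ≤ (n−1)(c−1) (otherwise the bound is negative), and excluding n = c = 2 with ε < 1/2 and log(4ε²+1) > e^{−1/2}, where the mixing time is 1 but the bound is below 1; the claim is false in the excluded cases. *)

theory Defs
  imports "HOL-Probability.Probability"
begin

text \<open>
  Residues modulo \<open>G n\<close> are represented by \<open>{..<G n}\<close>. The sequence \<open>G\<close> is indexed from 1;
  the value \<open>G 0\<close> is never used.
\<close>

definition walk_step :: "(nat \<Rightarrow> nat) \<Rightarrow> nat \<Rightarrow> nat \<Rightarrow> nat pmf" where
  "walk_step G n x = map_pmf (\<lambda>z. (x + z) mod G n) (pmf_of_set (G ` {1..n}))"

primrec walk_dist :: "(nat \<Rightarrow> nat) \<Rightarrow> nat \<Rightarrow> nat \<Rightarrow> nat pmf" where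
  "walk_dist G n 0 = return_pmf 0"
| "walk_dist G n (Suc t) = bind_pmf (walk_dist G n t) (walk_step G n)"

definition tv_dist :: "'a set \<Rightarrow> 'a pmf \<Rightarrow> 'a pmf \<Rightarrow> real" where
  "tv_dist S \<mu> \<eta> = 1 / 2 * (\<Sum>x\<in>S. \<bar>pmf \<mu> x - pmf \<eta> x\<bar>)"

definition t_mix :: "(nat \<Rightarrow> nat) \<Rightarrow> nat \<Rightarrow> real \<Rightarrow> nat" where
  "t_mix G n \<epsilon> =
    (LEAST t. tv_dist {..<G n} (walk_dist G n t) (pmf_of_set {..<G n}) \<le> \<epsilon>)"

definition geom_seq :: "nat \<Rightarrow> nat \<Rightarrow> nat" where
  "geom_seq c k = c ^ (k - 1)"

end

theory Submission
  imports Defs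
begin

text \<open>
  Write \<open>m = n - 1\<close>, \<open>N = c ^ m\<close> and \<open>s = (sin (pi / (2 * c)))\<^sup>2\<close>, so that
  \<open>1 / \<kappa> = 1 - cos (pi / c) = 2 * s\<close>. By Plancherel and Cauchy-Schwarz, four times the squared
  distance from uniformity at time \<open>t\<close> is at most the sum of \<open>\<bar>\<lambda>\<^sub>k\<bar> ^ (2 * t)\<close> over \<open>0 < k < N\<close>, where
  \<open>\<lambda>\<^sub>k\<close> is the average of the unit complex numbers \<open>z\<^sub>i = cis (2 * pi * k / c ^ i)\<close> for \<open>i \<le> m\<close>
  (\<open>tv_dist_uniform_le_fourier\<close>, \<open>fourier_walk_dist\<close>).

  Bounding only the real parts of the \<open>z\<^sub>i\<close> does not control \<open>\<bar>\<lambda>\<^sub>k\<bar>\<close>: if \<open>k / N\<close> is close to a fixed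
  point of multiplication by \<open>c\<close> on the circle, almost all \<open>z\<^sub>i\<close> nearly agree with each other although
  they are far from 1. What matters is how consecutive \<open>z\<^sub>i\<close> differ. Averaging over adjacent pairs gives
  \<open>(m + 1) * \<bar>\<lambda>\<^sub>k\<bar> \<le> m + 1 - D ((c - 1) * k)\<close>, where \<open>D k\<close> sums \<open>1 - \<bar>cos (pi * k / c ^ i)\<bar>\<close> over
  \<open>1 \<le> i \<le> m\<close>; the factor \<open>c - 1\<close> is invertible modulo \<open>N\<close> and only permutes the frequencies
  (\<open>tv_dist_geom_walk_le\<close>).

  Expand \<open>k\<close> in base \<open>c\<close> with digits of least absolute value, and let \<open>w\<close> be the number of nonzero
  ones. At each of these positions \<open>k / c ^ i\<close> is at distance at least \<open>1 / (2 * c)\<close> from the integers.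
  A term close to this extreme contributes less than \<open>s\<close>, but then its neighbour, at \<open>k / c ^ (i - 1)\<close>,
  is close to the maximum 1. Charging a third of each term to its neighbour evens this out and yields \<open>D k \<ge> s * w\<close>
  (\<open>amortized_defect\<close>, \<open>total_defect_ge_weight\<close>). Since \<open>m choose w\<close> times \<open>(c - 1) ^ w\<close> frequencies
  have weight \<open>w\<close>, the sum over all nonzero frequencies is at most
  \<open>exp (m * (c - 1) * exp (- 2 * s * t / n)) - 1\<close>, and this is at most \<open>4 * \<epsilon>\<^sup>2\<close> once \<open>t\<close> reaches the
  bound \<open>T\<close> of the theorem.

  The mixing time is an integer, so the estimate is needed at \<open>t = \<lfloor>T\<rfloor>\<close>, possibly almost one
  step before \<open>T\<close>. Hence the previous bound has to hold at time \<open>t\<close> with \<open>t + 1\<close> on its right-hand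
  side (\<open>tv_dist_geom_walk_le_next\<close>). Two sources of slack pay for this step: \<open>D k \<ge> 2 * s\<close> for every
  \<open>k\<close> that is nonzero modulo \<open>N\<close>, which settles weight 1, and the gap between \<open>m choose w\<close> and
  \<open>m ^ w / fact w\<close>, which settles larger weights, in base 2 with a sharper bound on \<open>D k\<close> for weight 2
  (\<open>total_defect_time_shift\<close>, \<open>total_defect_base_two\<close>). The remaining times,
  \<open>t = 0\<close> and, for \<open>c = 2\<close> and \<open>m \<ge> 3\<close>, also \<open>t = 1\<close>, follow from the trivial bound \<open>1 - 1 / N\<close> on the
  distance. The walk on two points at \<open>t = 0\<close> is the one place where the comparison fails; there the
  hypotheses give \<open>\<epsilon> \<ge> 1 / 2\<close>, which is its distance from uniformity.
\<close>

section \<open>Fourier analysis on a cyclic group\<close>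

definition character :: "nat \<Rightarrow> nat \<Rightarrow> nat \<Rightarrow> complex" where
  "character N k x = cis (2 * pi * (real k * real x / real N))"

lemma cis_times_cnj_eq_1: "cis t * cnj (cis t) = 1"
  by (simp add: cis_cnj cis_mult)

lemma character_eq_power: "character N k x = cis (2 * pi * real x / real N) ^ k"
  by (simp add: character_def Complex.DeMoivre mult_ac)

lemma character_add: "character N k (x + y) = character N k x * character N k y"
  by (simp add: character_def cis_mult add_divide_distrib distrib_left)

lemma character_mod:
  assumes "N > 0"
  shows "character N k (x mod N) = character N k x"
proof -
  have "character N k (N * j) = 1" for j
    using assms cis_multiple_2pi[of "real (k * j)"] by (simp add: character_def)
  then show ?thesis
    using character_add[of N k "x mod N" "N * (x div N)"] by simp
qed

lemma character_orthogonality: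
  assumes x: "x < N" and y: "y < N"
  shows "(\<Sum>k<N. character N k x * cnj (character N k y)) = (if x = y then of_nat N else 0)"
proof -
  define a where "a j = cis (2 * pi * real j / real N)" for j :: nat
  define z where "z = a x * cnj (a y)"
  have N: "N > 0" using x by simp
  have "(\<Sum>k<N. character N k x * cnj (character N k y)) = (\<Sum>k<N. z ^ k)"
    by (simp add: character_eq_power z_def a_def power_mult_distrib)
  also have "\<dots> = (if x = y then of_nat N else 0)"
  proof (cases "x = y")
    case True
    then have "z = 1" unfolding z_def a_def by (simp add: cis_times_cnj_eq_1)
    then show ?thesis using True by simp
  next
    case False
    have root: "a j ^ N = 1" for j
      using N cis_multiple_2pi[of "real j"] by (simp add: a_def Complex.DeMoivre)
    have "z ^ N = 1" by (simp add: z_def power_mult_distrib root flip: complex_cnj_power)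
    moreover have "z \<noteq> 1"
    proof
      assume "z = 1"
      then have "a x * cnj (a y) * a y = a y" by (simp add: z_def)
      then have "a x = a y" using cis_times_cnj_eq_1 by (simp add: a_def mult_ac)
      moreover have "inj_on a {..<N}"
        using Complex.bij_betw_roots_unity[OF N] by (simp add: bij_betw_def a_def[abs_def])
      ultimately show False using x y False by (auto dest: inj_onD)
    qed
    ultimately show ?thesis using False by (simp add: geometric_sum)
  qed
  finally show ?thesis .
qed

definition fourier :: "nat \<Rightarrow> nat pmf \<Rightarrow> nat \<Rightarrow> complex" where
  "fourier N \<mu> k = measure_pmf.expectation \<mu> (character N k)"

lemma fourier_eq_sum:
  "set_pmf \<mu> \<subseteq> {..<N} \<Longrightarrow>
    fourier N \<mu> k = (\<Sum>x<N. of_real (pmf \<mu> x) * character N k x)"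
  unfolding fourier_def by (subst integral_measure_pmf[of "{..<N}"]) (auto simp: scaleR_conv_of_real)

lemma plancherel:
  assumes "set_pmf \<mu> \<subseteq> {..<N}"
  shows "(\<Sum>k<N. (cmod (fourier N \<mu> k))\<^sup>2) = real N * (\<Sum>x<N. (pmf \<mu> x)\<^sup>2)"
proof -
  let ?p = "\<lambda>x. complex_of_real (pmf \<mu> x)"
  have "complex_of_real (\<Sum>k<N. (cmod (fourier N \<mu> k))\<^sup>2) =
      (\<Sum>k<N. \<Sum>x<N. \<Sum>y<N. ?p x * ?p y * (character N k x * cnj (character N k y)))"
    by (simp add: complex_norm_square fourier_eq_sum[OF assms] sum_product mult_ac
        del: of_real_power)
  also have "\<dots> = (\<Sum>x<N. \<Sum>k<N. \<Sum>y<N. ?p x * ?p y * (character N k x * cnj (character N k y)))"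
    by (rule sum.swap)
  also have "\<dots> = (\<Sum>x<N. \<Sum>y<N. \<Sum>k<N. ?p x * ?p y * (character N k x * cnj (character N k y)))"
    by (intro sum.cong refl sum.swap)
  also have "\<dots> = (\<Sum>x<N. \<Sum>y<N. if x = y then ?p x * ?p y * of_nat N else 0)"
    by (intro sum.cong refl)
       (simp add: character_orthogonality flip: sum_distrib_left)
  also have "\<dots> = complex_of_real (real N * (\<Sum>x<N. (pmf \<mu> x)\<^sup>2))"
    by (simp add: sum_distrib_left power2_eq_square mult_ac)
  finally show ?thesis by (simp only: of_real_eq_iff)
qed

text \<open>
  The squared 1-norm of \<open>\<mu> - 1 / N\<close> is at most \<open>N\<close> times its squared 2-norm, and subtracting the
  uniform distribution removes exactly the Fourier coefficient at 0.
\<close>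
lemma tv_dist_uniform_le_fourier:
  assumes "set_pmf \<mu> \<subseteq> {..<N}" "N > 0"
  shows "4 * (tv_dist {..<N} \<mu> (pmf_of_set {..<N}))\<^sup>2 \<le> (\<Sum>k\<in>{1..<N}. (cmod (fourier N \<mu> k))\<^sup>2)"
proof -
  have one: "(\<Sum>x<N. pmf \<mu> x) = 1" using assms by (intro sum_pmf_eq_1) auto
  have "4 * (tv_dist {..<N} \<mu> (pmf_of_set {..<N}))\<^sup>2 = (\<Sum>x<N. \<bar>pmf \<mu> x - 1 / real N\<bar>)\<^sup>2"
    using assms by (simp add: tv_dist_def power_divide lessThan_empty_iff)
  also have "\<dots> \<le> (\<Sum>x<N. \<bar>pmf \<mu> x - 1 / real N\<bar>\<^sup>2) * real N"
    using sum_squared_le_sum_of_squares[of "\<lambda>x. \<bar>pmf \<mu> x - 1 / real N\<bar>" "{..<N}"] by simp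
  also have "(\<Sum>x<N. \<bar>pmf \<mu> x - 1 / real N\<bar>\<^sup>2) =
      (\<Sum>x<N. (pmf \<mu> x)\<^sup>2) - 2 / real N * (\<Sum>x<N. pmf \<mu> x) + 1 / real N"
  proof -
    have "\<bar>pmf \<mu> x - 1 / real N\<bar>\<^sup>2 = (pmf \<mu> x)\<^sup>2 - 2 / real N * pmf \<mu> x + 1 / (real N)\<^sup>2" for x
      by (simp add: power2_diff power_divide)
    then show ?thesis
      using assms by (simp add: sum.distrib sum_subtractf sum_distrib_left power2_eq_square)
  qed
  also have "\<dots> * real N = real N * (\<Sum>x<N. (pmf \<mu> x)\<^sup>2) - 1"
    using assms by (simp add: one field_simps)
  also have "\<dots> = (\<Sum>k<N. (cmod (fourier N \<mu> k))\<^sup>2) - 1"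
    by (simp add: plancherel[OF assms(1)])
  also have "\<dots> = (\<Sum>k\<in>{1..<N}. (cmod (fourier N \<mu> k))\<^sup>2)"
  proof -
    have "fourier N \<mu> 0 = 1" by (simp add: fourier_def character_def[abs_def])
    moreover have "{..<N} = insert 0 {1..<N}" using assms by auto
    ultimately show ?thesis by simp
  qed
  finally show ?thesis .
qed

lemma set_walk_dist: "G n > 0 \<Longrightarrow> set_pmf (walk_dist G n t) \<subseteq> {..<G n}"
  by (induction t) (auto simp: walk_step_def)

text \<open>
  Characters turn addition into multiplication, so every step multiplies the Fourier coefficient by
  the average of the character over the set of increments.
\<close>
lemma fourier_walk_dist:
  assumes "G n > 0" "n \<ge> 1"
  shows "fourier (G n) (walk_dist G n t) k =
    ((\<Sum>z\<in>G ` {1..n}. character (G n) k z) / of_nat (card (G ` {1..n}))) ^ t"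
proof (induction t)
  case 0
  show ?case by (simp add: fourier_def character_def)
next
  case (Suc t)
  let ?lam = "(\<Sum>z\<in>G ` {1..n}. character (G n) k z) / of_nat (card (G ` {1..n}))"
  have ne: "G ` {1..n} \<noteq> {}" using assms by auto
  have step: "measure_pmf.expectation (walk_step G n x) (character (G n) k) = character (G n) k x * ?lam" for x
  proof -
    have "measure_pmf.expectation (walk_step G n x) (character (G n) k) =
        (\<Sum>z\<in>G ` {1..n}. pmf (pmf_of_set (G ` {1..n})) z *\<^sub>R character (G n) k ((x + z) mod G n))"
      unfolding walk_step_def integral_map_pmf
      using ne by (intro integral_measure_pmf) auto
    also have "\<dots> = character (G n) k x * ?lam"
      using ne assms
      by (simp add: character_mod character_add scaleR_conv_of_real sum_distrib_left
          sum_divide_distrib)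
    finally show ?thesis .
  qed
  have "fourier (G n) (walk_dist G n (Suc t)) k =
      (\<Sum>x<G n. pmf (walk_dist G n t) x *\<^sub>R (character (G n) k x * ?lam))"
    unfolding fourier_def walk_dist.simps
    by (subst pmf_expectation_bind[of "{..<G n}"])
       (use set_walk_dist[of G n t] assms ne in \<open>auto simp only: step, auto simp: walk_step_def\<close>)
  also have "\<dots> = (\<Sum>x<G n. of_real (pmf (walk_dist G n t) x) * character (G n) k x) * ?lam"
    by (simp only: scaleR_conv_of_real sum_distrib_right mult.assoc)
  also have "\<dots> = ?lam ^ t * ?lam"
    by (simp add: fourier_eq_sum[OF set_walk_dist, symmetric] assms Suc.IH)
  finally show ?case by simp
qed

text \<open>
  Among all distributions the point masses are farthest from the uniform one: \<open>\<bar>p - u\<bar>\<close> is convex in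
  \<open>p\<close>, hence lies below its chord over the unit interval, and the chord sums to the value that a
  point mass attains.
\<close>
lemma tv_dist_uniform_le:
  assumes "set_pmf \<mu> \<subseteq> {..<N}" "N > 0"
  shows "tv_dist {..<N} \<mu> (pmf_of_set {..<N}) \<le> 1 - 1 / real N"
proof -
  have one: "(\<Sum>x<N. pmf \<mu> x) = 1" using assms by (intro sum_pmf_eq_1) auto
  have chord: "\<bar>p - u\<bar> \<le> p * (1 - 2 * u) + u" if "0 \<le> p" "p \<le> 1" "0 \<le> u" "u \<le> 1" for p u :: real
  proof -
    have "0 \<le> p * (1 - u)" "0 \<le> u * (1 - p)" using that by auto
    then show ?thesis by (simp add: abs_le_iff algebra_simps)
  qed
  have "(\<Sum>x<N. \<bar>pmf \<mu> x - pmf (pmf_of_set {..<N}) x\<bar>) \<le>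
      (\<Sum>x<N. pmf \<mu> x * (1 - 2 * (1 / real N)) + 1 / real N)"
  proof (rule sum_mono)
    fix x assume "x \<in> {..<N}"
    then have "pmf (pmf_of_set {..<N}) x = 1 / real N"
      using assms(2) by (subst pmf_of_set) auto
    then show "\<bar>pmf \<mu> x - pmf (pmf_of_set {..<N}) x\<bar> \<le> pmf \<mu> x * (1 - 2 * (1 / real N)) + 1 / real N"
      using chord[of "pmf \<mu> x" "1 / real N"] assms(2) by (simp add: pmf_le_1)
  qed
  also have "\<dots> = 2 * (1 - 1 / real N)"
    using assms by (simp add: sum.distrib one flip: sum_distrib_right)
  finally show ?thesis by (simp add: tv_dist_def)
qed

section \<open>The defect of a frequency\<close>

text \<open>
  Half the length lost when two unit complex numbers whose arguments differ by \<open>2 * pi * y\<close> are added,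
  see \<open>norm_cis_add_cis\<close>. It has period 1 and vanishes exactly at the integers.
\<close>
definition defect :: "real \<Rightarrow> real" where
  "defect y = 1 - \<bar>cos (pi * y)\<bar>"

definition total_defect :: "nat \<Rightarrow> nat \<Rightarrow> nat \<Rightarrow> real" where
  "total_defect c m k = (\<Sum>i=1..m. defect (real k / real c ^ i))"

lemma defect_nonneg: "0 \<le> defect y"
  by (simp add: defect_def)

lemma defect_uminus: "defect (- y) = defect y"
  by (simp add: defect_def)

lemma defect_add_nat: "defect (y + real j) = defect y"
proof (induction j)
  case (Suc j)
  have "cos (pi * (y + real (Suc j))) = - cos (pi * (y + real j))"
    using cos_periodic_pi[of "pi * (y + real j)"] by (simp add: algebra_simps)
  then show ?case using Suc by (simp add: defect_def)
qed simp

lemma defect_nat_diff: "defect (real j - y) = defect y"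
  using defect_add_nat[of "-y" j] by (simp add: defect_uminus)

lemma total_defect_0 [simp]: "total_defect c 0 k = 0"
  by (simp add: total_defect_def)

lemma total_defect_nonneg: "0 \<le> total_defect c m k"
  by (auto simp: total_defect_def intro: sum_nonneg defect_nonneg)

lemma defect_mod:
  assumes "c > 0" "i \<le> m"
  shows "defect (real (k mod c ^ m) / real c ^ i) = defect (real k / real c ^ i)"
proof -
  have "real k = real (k mod c ^ m) + real c ^ m * real (k div c ^ m)"
    by (metis mod_mult_div_eq of_nat_add of_nat_mult of_nat_power)
  moreover have "real c ^ m = real c ^ i * real c ^ (m - i)"
    using assms by (simp flip: power_add)
  ultimately have "real k / real c ^ i =
      real (k mod c ^ m) / real c ^ i + real (c ^ (m - i) * (k div c ^ m))"
    using assms by (simp add: add_divide_distrib)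
  then show ?thesis using defect_add_nat by metis
qed

lemma total_defect_mod: "c > 0 \<Longrightarrow> total_defect c m (k mod c ^ m) = total_defect c m k"
  unfolding total_defect_def by (intro sum.cong refl defect_mod) auto

text \<open>
  The recursion used in all inductions below: dropping the leading digit of \<open>k\<close> does not change the
  earlier terms because these depend only on \<open>k\<close> modulo lower powers of \<open>c\<close>.
\<close>
lemma total_defect_Suc:
  "c > 0 \<Longrightarrow> total_defect c (Suc m) k =
    total_defect c m (k mod c ^ m) + defect (real k / real c ^ Suc m)"
  by (simp only: total_defect_mod) (simp add: total_defect_def)

lemma norm_cis_add_cis: "cmod (cis a + cis b) = 2 * \<bar>cos ((a - b) / 2)\<bar>"
proof -
  have "cis a + cis b = of_real (2 * cos ((a - b) / 2)) * cis ((a + b) / 2)"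
    by (simp add: complex_eq_iff cos_plus_cos sin_plus_sin)
  then show ?thesis by (simp add: norm_mult)
qed

text \<open>
  Twice the sum consists of all adjacent pairs and the two end points.
\<close>
lemma norm_sum_le_adjacent_pairs:
  fixes z :: "nat \<Rightarrow> 'a::real_normed_vector"
  assumes "norm (z 0) \<le> 1" "norm (z m) \<le> 1"
  shows "norm (\<Sum>i\<le>m. z i) \<le> 1 + (\<Sum>i=1..m. norm (z (i - 1) + z i) / 2)"
proof -
  have "2 *\<^sub>R (\<Sum>i\<le>m. z i) = z 0 + z m + (\<Sum>i=1..m. z (i - 1) + z i)"
    by (induction m) (simp_all add: scaleR_2 algebra_simps)
  then have "2 * norm (\<Sum>i\<le>m. z i) = norm (z 0 + z m + (\<Sum>i=1..m. z (i - 1) + z i))"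
    by (metis norm_scaleR abs_numeral)
  also have "\<dots> \<le> norm (z 0) + norm (z m) + (\<Sum>i=1..m. norm (z (i - 1) + z i))"
    by (intro norm_triangle_mono norm_sum order_refl)
  finally show ?thesis using assms by (simp flip: sum_divide_distrib)
qed

text \<open>
  The factor \<open>c - 1\<close> appears because consecutive angles \<open>k / c ^ (i - 1)\<close> and \<open>k / c ^ i\<close> differ by
  \<open>(c - 1) * k / c ^ i\<close>.
\<close>
lemma norm_sum_cis_le_total_defect:
  assumes "c > 0"
  shows "cmod (\<Sum>i\<le>m. cis (2 * pi * (real k / real c ^ i))) \<le>
    real m + 1 - total_defect c m ((c - 1) * k)"
proof -
  have "cmod (\<Sum>i\<le>m. cis (2 * pi * (real k / real c ^ i))) \<le>
      1 + (\<Sum>i=1..m. cmod (cis (2 * pi * (real k / real c ^ (i - 1))) +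
        cis (2 * pi * (real k / real c ^ i))) / 2)"
    by (rule norm_sum_le_adjacent_pairs) auto
  also have "\<dots> = 1 + (\<Sum>i=1..m. 1 - defect (real ((c - 1) * k) / real c ^ i))"
  proof -
    have "cmod (cis (2 * pi * (real k / real c ^ (i - 1))) +
        cis (2 * pi * (real k / real c ^ i))) / 2 =
        1 - defect (real ((c - 1) * k) / real c ^ i)" if "i \<in> {1..m}" for i
    proof -
      obtain j where "i = Suc j" using \<open>i \<in> {1..m}\<close> by (cases i) auto
      then have "(2 * pi * (real k / real c ^ (i - 1)) - 2 * pi * (real k / real c ^ i)) / 2 =
          pi * (real ((c - 1) * k) / real c ^ i)"
        using assms by (simp add: of_nat_diff field_simps)
      then show ?thesis by (simp add: norm_cis_add_cis defect_def)
    qed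
    then show ?thesis by (intro arg_cong2[where f = plus] refl sum.cong) simp_all
  qed
  also have "\<dots> = real m + 1 - total_defect c m ((c - 1) * k)"
    by (simp add: total_defect_def sum_subtractf)
  finally show ?thesis .
qed

text \<open>
  The last increment \<open>c ^ m\<close> is 0 modulo \<open>c ^ m\<close>. It supplies the term \<open>i = 0\<close>, equal to 1, at which
  the chain of angles \<open>k / c ^ i\<close> starts.
\<close>
lemma fourier_geom_walk_le:
  assumes "c > 1"
  shows "(cmod (fourier (c ^ m) (walk_dist (geom_seq c) (Suc m) t) k))\<^sup>2 \<le>
    exp (- (2 * real t * total_defect c m ((c - 1) * k) / (real m + 1)))"
proof -
  let ?G = "geom_seq c" and ?D = "total_defect c m ((c - 1) * k)"
  define S where "S = (\<Sum>i\<le>m. cis (2 * pi * (real k / real c ^ i)))"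
  have N: "?G (Suc m) = c ^ m" by (simp add: geom_seq_def)
  have "{1..Suc m} = Suc ` {..m}" by (simp add: atMost_atLeast0)
  then have steps: "?G ` {1..Suc m} = (\<lambda>i. c ^ i) ` {..m}"
    by (simp add: geom_seq_def image_image)
  have inj: "inj_on (\<lambda>i. c ^ i) {..m}" using assms by (auto simp: inj_on_def)
  have "(\<Sum>z\<in>?G ` {1..Suc m}. character (c ^ m) k z) =
      (\<Sum>i\<le>m. cis (2 * pi * (real k * real c ^ i / real c ^ m)))"
    unfolding steps by (simp add: sum.reindex[OF inj] character_def)
  also have "\<dots> = S"
    unfolding S_def using assms
    by (intro sum.reindex_bij_witness[of _ "\<lambda>i. m - i" "\<lambda>i. m - i"]) (auto simp: power_diff)
  finally have F: "fourier (c ^ m) (walk_dist ?G (Suc m) t) k = (S / of_nat (Suc m)) ^ t"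
    using fourier_walk_dist[of ?G "Suc m" t k] assms card_image[OF inj]
    unfolding N steps by simp
  have "cmod S / (real m + 1) \<le> (real m + 1 - ?D) / (real m + 1)"
    unfolding S_def using assms by (intro divide_right_mono norm_sum_cis_le_total_defect) auto
  also have "\<dots> = 1 + - (?D / (real m + 1))" by (simp add: diff_divide_distrib)
  also have "\<dots> \<le> exp (- (?D / (real m + 1)))" by (rule exp_ge_add_one_self)
  finally have "(cmod S / (real m + 1)) ^ (2 * t) \<le> exp (- (?D / (real m + 1))) ^ (2 * t)"
    by (intro power_mono) auto
  also have "\<dots> = exp (- (2 * real t * ?D / (real m + 1)))"
    by (subst exp_of_nat_mult[symmetric]) simp
  also have "(cmod S / (real m + 1)) ^ (2 * t) =
      (cmod (fourier (c ^ m) (walk_dist ?G (Suc m) t) k))\<^sup>2"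
    unfolding F by (simp add: norm_power norm_divide power_mult add.commute flip: of_nat_Suc)
       (simp add: power_mult[symmetric] mult.commute)
  finally show ?thesis .
qed

lemma bij_betw_mult_mod:
  fixes a N :: nat
  assumes "coprime a N"
  shows "bij_betw (\<lambda>k. a * k mod N) {1..<N} {1..<N}"
proof -
  have le: "x \<le> y" if "x < N" "y < N" "a * x mod N = a * y mod N" for x y
  proof (rule ccontr)
    assume "\<not> x \<le> y"
    then have "N dvd a * (x - y)"
      using that(3) mod_eq_dvd_iff_nat[of "a * y" "a * x" N] by (simp add: diff_mult_distrib2)
    then have "N dvd x - y"
      using assms by (simp add: coprime_dvd_mult_right_iff coprime_commute)
    then show False using \<open>\<not> x \<le> y\<close> that(1) by (auto dest: dvd_imp_le)
  qed
  have inj: "inj_on (\<lambda>k. a * k mod N) {..<N}"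
    by (intro inj_onI antisym) (auto intro: le)
  have "(\<lambda>k. a * k mod N) ` {1..<N} \<subseteq> {1..<N}"
  proof safe
    fix k assume k: "k \<in> {1..<N}"
    have "a * k mod N \<noteq> a * 0 mod N" using inj_onD[OF inj, of k 0] k by auto
    then show "a * k mod N \<in> {1..<N}" using k by auto
  qed
  moreover have "inj_on (\<lambda>k. a * k mod N) {1..<N}" by (rule inj_on_subset[OF inj]) auto
  ultimately show ?thesis by (simp add: bij_betw_def endo_inj_surj)
qed

text \<open>
  Since \<open>c - 1\<close> is coprime to \<open>c ^ m\<close>, the substitution of \<open>(c - 1) * k\<close> for \<open>k\<close> permutes the nonzero
  residues and disappears from the sum.
\<close>
lemma tv_dist_geom_walk_le:
  assumes c: "c > 1"
  shows "4 * (tv_dist {..<c ^ m} (walk_dist (geom_seq c) (Suc m) t) (pmf_of_set {..<c ^ m}))\<^sup>2 \<le>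
    (\<Sum>k\<in>{1..<c ^ m}. exp (- (2 * real t * total_defect c m k / (real m + 1))))"
proof -
  let ?f = "\<lambda>k. exp (- (2 * real t * total_defect c m k / (real m + 1)))"
  have "set_pmf (walk_dist (geom_seq c) (Suc m) t) \<subseteq> {..<c ^ m}"
    using set_walk_dist[of "geom_seq c" "Suc m" t] c by (simp add: geom_seq_def)
  then have "4 * (tv_dist {..<c ^ m} (walk_dist (geom_seq c) (Suc m) t) (pmf_of_set {..<c ^ m}))\<^sup>2 \<le>
      (\<Sum>k\<in>{1..<c ^ m}. (cmod (fourier (c ^ m) (walk_dist (geom_seq c) (Suc m) t) k))\<^sup>2)"
    using c by (intro tv_dist_uniform_le_fourier) auto
  also have "\<dots> \<le> (\<Sum>k\<in>{1..<c ^ m}. ?f ((c - 1) * k mod c ^ m))"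
    using c fourier_geom_walk_le[OF c] by (intro sum_mono) (simp add: total_defect_mod)
  also have "\<dots> = (\<Sum>k\<in>{1..<c ^ m}. ?f k)"
    using c by (intro sum.reindex_bij_betw bij_betw_mult_mod)
      (use coprime_diff_one_left_nat[of c] in auto)
  finally show ?thesis .
qed

section \<open>Balanced digits\<close>

text \<open>
  The number of nonzero digits in the balanced base-\<open>c\<close> expansion of \<open>k\<close> modulo \<open>c ^ m\<close>. If the
  remainder \<open>r\<close> below the leading digit satisfies \<open>2 * r \<le> c ^ m\<close>, it is read as itself, so the balanced
  leading digit is zero if the ordinary one is 0; otherwise it is read as \<open>r - c ^ m\<close> with a carry,
  so the balanced leading digit is zero if the ordinary one is \<open>c - 1\<close>.
\<close>
primrec balanced_weight :: "nat \<Rightarrow> nat \<Rightarrow> nat \<Rightarrow> nat" where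
  "balanced_weight c 0 k = 0"
| "balanced_weight c (Suc m) k = balanced_weight c m (k mod c ^ m) +
     (if k div c ^ m = (if 2 * (k mod c ^ m) \<le> c ^ m then 0 else c - 1) then 0 else 1)"

text \<open>
  Half of \<open>1 - cos (pi / c)\<close>, see \<open>gap_eq\<close>: the amount by which each nonzero balanced
  digit is guaranteed to raise the total defect, see \<open>total_defect_ge_weight\<close>.
\<close>
definition gap :: "nat \<Rightarrow> real" where
  "gap c = (sin (pi / (2 * real c)))\<^sup>2"

lemma gap_eq: "1 - cos (pi / real c) = 2 * gap c"
  using cos_double_sin[of "pi / (2 * real c)"] by (simp add: gap_def)

lemma gap_pos: "c > 1 \<Longrightarrow> gap c > 0"
  unfolding gap_def by (intro zero_less_power sin_gt_zero) (auto simp: field_simps)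

lemma gap_two: "gap 2 = 1 / 2"
  by (simp add: gap_def sin_45 power_divide)

lemma gap_le_quarter: "c \<ge> 3 \<Longrightarrow> gap c \<le> 1 / 4"
proof -
  assume c: "c \<ge> 3"
  have "pi / (2 * real c) \<le> pi / 6" using c by (intro divide_left_mono) auto
  then have "sin (pi / (2 * real c)) \<le> sin (pi / 6)"
    using c by (intro sin_monotone_2pi_le) (auto simp: field_simps intro: order_trans[of _ 0])
  moreover have "0 \<le> sin (pi / (2 * real c))" using c by (intro sin_ge_zero) (auto simp: field_simps)
  ultimately have "(sin (pi / (2 * real c)))\<^sup>2 \<le> (1/2)\<^sup>2"
    by (intro power_mono) (auto simp: sin_30)
  then show ?thesis by (simp add: gap_def power_divide)
qed

lemma gap_le_half: "c > 1 \<Longrightarrow> gap c \<le> 1 / 2"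
  using gap_two gap_le_quarter[of c] by (cases "c = 2") auto

lemma cos_pi_times_nonneg: "0 \<le> y \<Longrightarrow> y \<le> 1 / 2 \<Longrightarrow> 0 \<le> cos (pi * y)"
  using mult_left_mono[of y "1 / 2" pi] mult_nonneg_nonneg[of pi y] pi_ge_zero
  by (intro cos_ge_zero) linarith+

lemma defect_mono:
  assumes "0 \<le> x" "x \<le> y" "y \<le> 1 / 2"
  shows "defect x \<le> defect y"
proof -
  have "cos (pi * y) \<le> cos (pi * x)"
    using assms mult_left_mono[of y 1 pi] by (intro cos_monotone_0_pi_le) (auto intro: mult_left_mono)
  moreover have "0 \<le> cos (pi * y)" "0 \<le> cos (pi * x)"
    using assms by (auto intro: cos_pi_times_nonneg)
  ultimately show ?thesis by (simp add: defect_def)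
qed

lemma sin_scale_ge:
  assumes "0 \<le> a" "a \<le> pi" "0 \<le> x" "x \<le> 1"
  shows "x * sin a \<le> sin (x * a)"
proof -
  have "concave_on {0..pi} sin"
    by (rule f''_le0_imp_concave[where f' = cos and f'' = "\<lambda>x. - sin x"])
       (auto intro!: derivative_eq_intros sin_ge_zero)
  from concave_onD[OF this, of x 0 a] assms show ?thesis by simp
qed

lemma defect_ge_of_inverse_le:
  assumes "c > 1" "1 / real c \<le> y" "y \<le> 1 - 1 / real c"
  shows "2 * gap c \<le> defect y"
proof -
  have *: "2 * gap c \<le> defect y" if "1 / real c \<le> y" "y \<le> 1 / 2" for y
  proof -
    have "cos (pi / real c) \<ge> 0"
      using cos_pi_times_nonneg[of "1 / real c"] assms by simp
    then have "2 * gap c = defect (1 / real c)" by (simp add: defect_def flip: gap_eq)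
    also have "\<dots> \<le> defect y" using that by (intro defect_mono) auto
    finally show ?thesis .
  qed
  show ?thesis
    using *[of y] *[of "1 - y"] defect_nat_diff[of 1 y] assms by (cases "y \<le> 1 / 2") auto
qed

text \<open>
  Covers \<open>y = (1 - s) / c\<close> between \<open>1 / (2 * c)\<close> and \<open>1 / c\<close>, where \<open>defect y\<close> alone may fall below
  \<open>gap c\<close>; here \<open>defect (c * y) = defect s\<close>. The weights 2/3 and 1/3 are forced by \<open>c = 2\<close>: there equality holds at
  \<open>y = 1 / 3\<close>, which doubling maps to \<open>2 / 3\<close>, a point of the same defect, so that the derivative of
  the right-hand side must vanish at this point. For \<open>c \<ge> 3\<close> there is room to spare and concavity
  of the sine suffices.
\<close>
lemma amortized_defect_small:
  assumes c: "c > 1" and s: "0 \<le> s" "s \<le> 1 / 2"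
  shows "gap c \<le> 2 / 3 * defect ((1 - s) / real c) + 1 / 3 * defect s"
proof -
  have "0 \<le> (1 - s) / real c" "(1 - s) / real c \<le> 1 / 2"
    using s c by (auto simp: field_simps)
  then have cosy: "0 \<le> cos (pi * ((1 - s) / real c))" by (rule cos_pi_times_nonneg)
  have coss: "0 \<le> cos (pi * s)" using s by (rule cos_pi_times_nonneg)
  show ?thesis
  proof (cases "c = 2")
    case True
    define u where "u = cos (pi * ((1 - s) / 2))"
    have "cos (pi * s) = - cos (pi - pi * s)" by simp
    also have "pi - pi * s = 2 * (pi * ((1 - s) / 2))" by (simp add: algebra_simps)
    also have "cos \<dots> = 2 * u\<^sup>2 - 1" unfolding u_def by (rule cos_double_cos)
    finally have "defect s = 2 * u\<^sup>2" using coss by (simp add: defect_def)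
    moreover have "defect ((1 - s) / real c) = 1 - u" using cosy True by (simp add: defect_def u_def)
    \<comment> \<open>The claim becomes \<open>u\<^sup>2 - u + 1 \<ge> 3 / 4\<close>.\<close>
    moreover have "0 \<le> (u - 1 / 2)\<^sup>2" by simp
    ultimately show ?thesis using True by (simp add: gap_two power2_eq_square algebra_simps)
  next
    case False
    define a where "a = pi / (2 * real c)"
    have a: "0 \<le> a" "a \<le> pi" using c by (auto simp: a_def field_simps)
    have "(1 - s) * sin a \<le> sin ((1 - s) * a)" using s a by (intro sin_scale_ge) auto
    moreover have "0 \<le> (1 - s) * sin a" using s a by (intro mult_nonneg_nonneg sin_ge_zero) auto
    ultimately have "((1 - s) * sin a)\<^sup>2 \<le> (sin ((1 - s) * a))\<^sup>2" by (intro power_mono)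
    also have "2 * (sin ((1 - s) * a))\<^sup>2 = defect ((1 - s) / real c)"
      using cos_double_sin[of "(1 - s) * a"] cosy by (simp add: defect_def a_def mult.commute)
    finally have 1: "2 * (1 - s)\<^sup>2 * gap c \<le> defect ((1 - s) / real c)"
      by (simp add: gap_def a_def power_mult_distrib)
    have "(2 * s) * sin (pi / 4) \<le> sin ((2 * s) * (pi / 4))"
      using s by (intro sin_scale_ge) auto
    moreover have "0 \<le> (2 * s) * sin (pi / 4)" using s by (intro mult_nonneg_nonneg sin_ge_zero) auto
    ultimately have "((2 * s) * sin (pi / 4))\<^sup>2 \<le> (sin ((2 * s) * (pi / 4)))\<^sup>2"
      by (intro power_mono)
    also have "2 * (sin ((2 * s) * (pi / 4)))\<^sup>2 = defect s"
      using cos_double_sin[of "(2 * s) * (pi / 4)"] coss by (simp add: defect_def mult.commute)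
    finally have 2: "4 * s\<^sup>2 \<le> defect s"
      by (simp add: sin_45 power_mult_distrib power_divide)
    have g: "0 \<le> gap c" "gap c \<le> 1 / 4" using gap_le_quarter[of c] False c gap_pos[of c] by auto
    have "s\<^sup>2 * gap c \<le> s\<^sup>2 * (1/4)" using g by (intro mult_left_mono) auto
    then have "4 * s\<^sup>2 * 4 * gap c \<le> defect s" using 2 by simp
    \<comment> \<open>\<open>(1 - s)\<^sup>2 + 4 * s\<^sup>2 = (5 * s - 1)\<^sup>2 / 5 + 4 / 5\<close>, and \<open>4 / 5\<close> exceeds the \<open>3 / 4\<close> that is needed.\<close>
    moreover have "0 \<le> gap c * ((5 * s - 1)\<^sup>2 / 5)" using g by simp
    then have "4 / 5 * gap c \<le> gap c * (1 - s)\<^sup>2 + gap c * (4 * s\<^sup>2)"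
      by (simp add: power2_eq_square algebra_simps)
    ultimately show ?thesis using 1 g by (simp add: algebra_simps)
  qed
qed

text \<open>
  From \<open>1 / c\<close> to \<open>1 / 2\<close> the defect of \<open>y\<close> is already at least \<open>2 * gap c\<close>, and the reflection \<open>1 - y\<close>
  reduces the upper half of the interval to the lower half.
\<close>
lemma amortized_defect:
  assumes c: "c > 1" and y: "1 / (2 * real c) \<le> y" "y \<le> 1 - 1 / (2 * real c)"
  shows "gap c \<le> 2 / 3 * defect y + 1 / 3 * defect (real c * y)"
proof -
  have *: "gap c \<le> 2 / 3 * defect y + 1 / 3 * defect (real c * y)"
    if y: "1 / (2 * real c) \<le> y" "y \<le> 1 / 2" for y
  proof (cases "1 / real c \<le> y")
    case True
    have "1 / real c \<le> 1 / 2" using c by (simp add: field_simps)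
    then have "2 * gap c \<le> defect y" using c y True by (intro defect_ge_of_inverse_le) auto
    then show ?thesis using defect_nonneg[of "real c * y"] gap_pos[OF c] by linarith
  next
    case False
    define s where "s = 1 - real c * y"
    have "0 \<le> s" "s \<le> 1 / 2" using False y c by (auto simp: s_def field_simps)
    moreover have "(1 - s) / real c = y" using c by (simp add: s_def)
    moreover have "defect s = defect (real c * y)"
      using defect_nat_diff[of 1 "real c * y"] by (simp add: s_def)
    ultimately show ?thesis using amortized_defect_small[of c s] c by simp
  qed
  show ?thesis
  proof (cases "y \<le> 1 / 2")
    case False
    have "real c * (1 - y) = real c - real c * y" by (simp add: algebra_simps)
    then have "defect (real c * (1 - y)) = defect (real c * y)" by (simp add: defect_nat_diff)
    moreover have "defect (1 - y) = defect y" using defect_nat_diff[of 1 y] by simp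
    ultimately show ?thesis using *[of "1 - y"] False y by simp
  qed (use * y in auto)
qed

text \<open>
  A nonzero leading digit moves \<open>k / c ^ Suc m\<close> by at least \<open>1 / c\<close> away from the integers, and the
  balanced remainder moves it back by at most half of that.
\<close>
lemma top_digit_nonzero_bounds:
  assumes c: "c > 1" and k: "k < c ^ Suc m"
    and nz: "k div c ^ m \<noteq> (if 2 * (k mod c ^ m) \<le> c ^ m then 0 else c - 1)"
  shows "1 / (2 * real c) \<le> real k / real c ^ Suc m"
    and "real k / real c ^ Suc m \<le> 1 - 1 / (2 * real c)"
proof -
  define N r d where "N = c ^ m" and "r = k mod c ^ m" and "d = k div c ^ m"
  have N: "N > 0" using c by (simp add: N_def)
  have k_eq: "k = r + N * d" by (simp add: N_def r_def d_def)
  have r: "r < N" using N by (simp add: r_def N_def)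
  have d: "d < c" using k c by (simp add: d_def less_mult_imp_div_less)
  have "N \<le> 2 * k \<and> 2 * k + N \<le> 2 * (c * N)"
  proof (cases "2 * r \<le> N")
    case True
    then obtain e where "d = Suc e" using nz by (cases d) (simp_all add: N_def r_def d_def)
    moreover have "N * Suc d \<le> N * c" using d by (intro mult_left_mono) auto
    ultimately show ?thesis using True k_eq by (simp add: algebra_simps)
  next
    case False
    then have "Suc (Suc d) \<le> c" using nz d by (simp add: N_def r_def d_def)
    then have "N * Suc (Suc d) \<le> N * c" by (intro mult_left_mono) auto
    then show ?thesis using False r k_eq by (simp add: algebra_simps)
  qed
  then have "real N \<le> 2 * real k" "2 * real k + real N \<le> 2 * (real c * real N)"
    by (metis of_nat_le_iff of_nat_add of_nat_mult of_nat_numeral)+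
  then show "1 / (2 * real c) \<le> real k / real c ^ Suc m"
    and "real k / real c ^ Suc m \<le> 1 - 1 / (2 * real c)"
    using c N by (auto simp: N_def field_simps)
qed

text \<open>
  The extra third of the leading term makes the induction work: it is the share that the next
  leading term takes over, since \<open>k / c ^ m\<close> is \<open>c\<close> times the next argument.
\<close>
lemma total_defect_ge_weight:
  assumes c: "c > 1" and "k < c ^ m"
  shows "gap c * balanced_weight c m k + 1 / 3 * defect (real k / real c ^ m) \<le> total_defect c m k"
  using assms(2)
proof (induction m arbitrary: k)
  case 0
  then show ?case by (simp add: defect_def)
next
  case (Suc m)
  let ?r = "k mod c ^ m" and ?y = "real k / real c ^ Suc m"
  have "?r < c ^ m" using c by simp
  note Suc.IH[OF this]
  moreover have "defect (real ?r / real c ^ m) = defect (real c * ?y)"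
    using defect_mod[of c m m k] c by simp
  moreover have "gap c * (real (balanced_weight c (Suc m) k) - real (balanced_weight c m ?r))
      \<le> 2 / 3 * defect ?y + 1 / 3 * defect (real c * ?y)"
  proof (cases "k div c ^ m = (if 2 * ?r \<le> c ^ m then 0 else c - 1)")
    case True
    then show ?thesis using defect_nonneg[of ?y] defect_nonneg[of "real c * ?y"]
      by (simp del: power_Suc)
  next
    case False
    then show ?thesis
      using amortized_defect[OF c top_digit_nonzero_bounds[OF c Suc.prems False]]
      by (simp del: power_Suc)
  qed
  ultimately show ?case using c by (simp add: total_defect_Suc algebra_simps del: power_Suc balanced_weight.simps)
qed

text \<open>
  Among the arguments \<open>k / c ^ i\<close>, the first one that is not an integer is a multiple of \<open>1 / c\<close>, and
  its defect alone is at least \<open>2 * gap c\<close>.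
\<close>
lemma total_defect_ge_two_gaps:
  assumes c: "c > 1" and "k < c ^ m" "k \<noteq> 0"
  shows "2 * gap c \<le> total_defect c m k"
  using assms(2,3)
proof (induction m arbitrary: k)
  case (Suc m)
  show ?case
  proof (cases "k mod c ^ m = 0")
    case False
    have "2 * gap c \<le> total_defect c m (k mod c ^ m)" using Suc.IH[of "k mod c ^ m"] False c by simp
    then show ?thesis using c defect_nonneg[of "real k / real c ^ Suc m"]
      by (simp add: total_defect_Suc del: power_Suc)
  next
    case True
    then obtain d where d: "k = c ^ m * d" by auto
    then have "1 \<le> d" "d + 1 \<le> c" using Suc.prems by (auto simp: mult.commute)
    then have "1 / real c \<le> real d / real c" "real d / real c \<le> 1 - 1 / real c"
      using c by (auto simp: field_simps)
    moreover have "real k / real c ^ Suc m = real d / real c" using d c by simp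
    ultimately have "2 * gap c \<le> defect (real k / real c ^ Suc m)"
      using defect_ge_of_inverse_le[OF c] by simp
    then show ?thesis using c total_defect_nonneg[of c m "k mod c ^ m"]
      by (simp add: total_defect_Suc del: power_Suc)
  qed
qed simp

lemma balanced_weight_0: "balanced_weight c m 0 = 0"
  by (induction m) auto

lemma balanced_weight_eq_0_iff:
  assumes "c > 1" "k < c ^ m"
  shows "balanced_weight c m k = 0 \<longleftrightarrow> k = 0"
proof
  show "k = 0" if "balanced_weight c m k = 0" using assms(2) that
  proof (induction m arbitrary: k)
    case (Suc m)
    then have "k mod c ^ m = 0" using assms(1) by simp
    moreover from this Suc.prems have "k div c ^ m = 0" by (simp split: if_splits)
    ultimately show ?case by (metis add_0 mod_div_mult_eq mult_0)
  qed simp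
qed (simp add: balanced_weight_0)

text \<open>
  This sharpens the value 1 that \<open>total_defect_ge_weight\<close> guarantees for weight 2. The lowest nonzero
  digit contributes a term \<open>defect (1 / 2) = 1\<close>, and the next nonzero digit an argument at distance at
  least \<open>1 / 4\<close> from the integers, with defect at least \<open>1 - sqrt 2 / 2 \<ge> 1 / 4\<close>.
\<close>
lemma total_defect_base_two:
  assumes "k < 2 ^ m" "2 \<le> balanced_weight 2 m k"
  shows "5 / 4 \<le> total_defect 2 m k"
  using assms
proof (induction m arbitrary: k)
  case (Suc m)
  let ?r = "k mod 2 ^ m" and ?y = "real k / real 2 ^ Suc m"
  have split: "total_defect 2 (Suc m) k = total_defect 2 m ?r + defect ?y"
    using total_defect_Suc[of 2 m k] by (simp del: power_Suc)
  show ?case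
  proof (cases "2 \<le> balanced_weight 2 m ?r")
    case True
    then show ?thesis using Suc.IH[of ?r] split defect_nonneg[of ?y] by simp
  next
    case False
    then have nz: "k div 2 ^ m \<noteq> (if 2 * ?r \<le> 2 ^ m then 0 else 2 - 1)"
      and "balanced_weight 2 m ?r = 1" using Suc.prems by (auto split: if_splits)
    then have "?r \<noteq> 0" using balanced_weight_0[of 2 m] by (intro notI) simp
    then have "1 \<le> total_defect 2 m ?r"
      using total_defect_ge_two_gaps[of 2 ?r m] by (simp add: gap_two)
    moreover have "1 / 4 \<le> defect ?y"
    proof -
      have "sqrt 2 \<le> 3 / 2" by (rule real_le_lsqrt) (auto simp: power2_eq_square)
      then have q: "1 / 4 \<le> defect (1 / 4)" by (simp add: defect_def cos_45)
      have "1 / 4 \<le> ?y" "?y \<le> 3 / 4"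
        using top_digit_nonzero_bounds[of 2 k m] nz Suc.prems by (auto simp del: power_Suc)
      then show ?thesis
        using defect_mono[of "1/4" ?y] defect_mono[of "1/4" "1 - ?y"] defect_nat_diff[of 1 ?y] q
        by (cases "?y \<le> 1 / 2") (auto simp del: power_Suc)
    qed
    ultimately show ?thesis using split by simp
  qed
qed simp

section \<open>Summing over all frequencies\<close>

text \<open>
  For each remainder exactly one of the \<open>c\<close> leading digits is a balanced zero, so the weight is
  distributed like a sum of independent digits. The induction turns Pascal's rule into a statement
  about the test function \<open>g\<close>.
\<close>
lemma sum_over_balanced_weight:
  fixes g :: "nat \<Rightarrow> real"
  assumes c: "c > 1"
  shows "(\<Sum>k<c ^ m. g (balanced_weight c m k)) =
    (\<Sum>w\<le>m. real (m choose w) * (real c - 1) ^ w * g w)"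
proof (induction m arbitrary: g)
  case (Suc m)
  let ?N = "c ^ m"
  have "(\<Sum>k<c ^ Suc m. g (balanced_weight c (Suc m) k)) =
      (\<Sum>d<c. \<Sum>k\<in>{d * ?N..<d * ?N + ?N}. g (balanced_weight c (Suc m) k))"
    by (subst sum.nat_group) simp
  also have "\<dots> = (\<Sum>d<c. \<Sum>r<?N. g (balanced_weight c (Suc m) (r + d * ?N)))"
  proof (rule sum.cong[OF refl])
    fix d
    show "(\<Sum>k\<in>{d * ?N..<d * ?N + ?N}. g (balanced_weight c (Suc m) k)) =
        (\<Sum>r<?N. g (balanced_weight c (Suc m) (r + d * ?N)))"
      using sum.shift_bounds_nat_ivl[of "\<lambda>k. g (balanced_weight c (Suc m) k)" 0 "d * ?N" ?N]
      by (simp add: lessThan_atLeast0 add.commute)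
  qed
  also have "\<dots> = (\<Sum>r<?N. \<Sum>d<c. g (balanced_weight c (Suc m) (r + d * ?N)))" by (rule sum.swap)
  also have "\<dots> = (\<Sum>r<?N. g (balanced_weight c m r) + (real c - 1) * g (Suc (balanced_weight c m r)))"
  proof (intro sum.cong refl)
    fix r assume r: "r \<in> {..<?N}"
    \<comment> \<open>The leading digit that is a balanced zero above the remainder \<open>r\<close>.\<close>
    define d0 where "d0 = (if 2 * r \<le> ?N then 0 else c - 1)"
    have d0: "d0 \<in> {..<c}" using c by (auto simp: d0_def)
    have "(\<Sum>d<c. g (balanced_weight c (Suc m) (r + d * ?N))) =
        (\<Sum>d<c. if d = d0 then g (balanced_weight c m r) else g (Suc (balanced_weight c m r)))"
      using r by (intro sum.cong) (auto simp: d0_def)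
    also have "\<dots> = g (balanced_weight c m r) + (\<Sum>d\<in>{..<c} - {d0}. g (Suc (balanced_weight c m r)))"
      using d0 by (subst sum.remove[of _ d0]) auto
    also have "card ({..<c} - {d0}) = c - 1" using d0 by simp
    then have "(\<Sum>d\<in>{..<c} - {d0}. g (Suc (balanced_weight c m r))) = (real c - 1) * g (Suc (balanced_weight c m r))"
      using c by (simp add: of_nat_diff)
    finally show "(\<Sum>d<c. g (balanced_weight c (Suc m) (r + d * ?N))) =
        g (balanced_weight c m r) + (real c - 1) * g (Suc (balanced_weight c m r))" .
  qed
  also have "\<dots> = (\<Sum>w\<le>m. real (m choose w) * (real c - 1) ^ w * (g w + (real c - 1) * g (Suc w)))"
    by (rule Suc.IH)
  also have "\<dots> = (\<Sum>w\<le>m. real (m choose w) * (real c - 1) ^ w * g w) +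
      (\<Sum>w\<le>m. real (m choose w) * (real c - 1) ^ Suc w * g (Suc w))"
    by (simp add: distrib_left sum.distrib mult_ac)
  also have "(\<Sum>w\<le>m. real (m choose w) * (real c - 1) ^ w * g w) =
      g 0 + (\<Sum>w\<le>m. real (m choose Suc w) * (real c - 1) ^ Suc w * g (Suc w))"
  proof -
    have "(\<Sum>w\<le>m. real (m choose w) * (real c - 1) ^ w * g w) =
        (\<Sum>w\<le>Suc m. real (m choose w) * (real c - 1) ^ w * g w)" by simp
    then show ?thesis by (subst (asm) sum.atMost_Suc_shift) simp
  qed
  also have "\<dots> + (\<Sum>w\<le>m. real (m choose w) * (real c - 1) ^ Suc w * g (Suc w)) =
      g 0 + (\<Sum>w\<le>m. real (Suc m choose Suc w) * (real c - 1) ^ Suc w * g (Suc w))"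
    by (simp add: distrib_left distrib_right sum.distrib)
  also have "\<dots> = (\<Sum>w\<le>Suc m. real (Suc m choose w) * (real c - 1) ^ w * g w)"
    by (subst sum.atMost_Suc_shift) (simp del: binomial_Suc_Suc)
  finally show ?case .
qed simp

text \<open>
  The falling factorial is \<open>m ^ w\<close> times the product of \<open>1 - i / m\<close> over \<open>i < w\<close>, and
  \<open>1 - x \<le> exp (- x)\<close>.
\<close>
lemma binomial_le_exp:
  assumes "m > 0"
  shows "real (m choose w) \<le> real m ^ w / fact w * exp (- (real w * (real w - 1) / (2 * real m)))"
proof (induction w)
  case (Suc w)
  show ?case
  proof (cases "w \<le> m")
    case True
    have "Suc w * (m choose Suc w) = (m - w) * (m choose w)"
      using binomial_absorption[of w m] binomial_absorb_comp[of m w] by simp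
    then have "real (Suc w) * real (m choose Suc w) = (real m - real w) * real (m choose w)"
      by (metis of_nat_mult of_nat_diff True)
    then have "real (m choose Suc w) = (real m - real w) * real (m choose w) / real (Suc w)"
      by (simp add: field_simps)
    also have "\<dots> \<le> (real m * exp (- (real w / real m))) *
        (real m ^ w / fact w * exp (- (real w * (real w - 1) / (2 * real m)))) / real (Suc w)"
    proof (intro divide_right_mono mult_mono Suc.IH)
      have "1 - real w / real m \<le> exp (- (real w / real m))"
        using exp_ge_add_one_self[of "- (real w / real m)"] by simp
      then have "real m * (1 - real w / real m) \<le> real m * exp (- (real w / real m))"
        by (intro mult_left_mono) auto
      moreover have "real m * (1 - real w / real m) = real m - real w"
        using assms by (simp add: field_simps)
      ultimately show "real m - real w \<le> real m * exp (- (real w / real m))"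
        by simp
    qed (use True in auto)
    also have "\<dots> = real m ^ Suc w / fact (Suc w) *
        (exp (- (real w / real m)) * exp (- (real w * (real w - 1) / (2 * real m))))"
      by (simp add: mult_ac)
    also have "exp (- (real w / real m)) * exp (- (real w * (real w - 1) / (2 * real m))) =
        exp (- (real (Suc w) * (real (Suc w) - 1) / (2 * real m)))"
      using assms by (simp flip: exp_add add: field_simps)
    finally show ?thesis .
  next
    case False
    then have "m choose Suc w = 0" by simp
    then show ?thesis by (simp only: of_nat_0) simp
  qed
qed simp

text \<open>
  Compares the exponents for a single frequency: the left-hand side is the decay wanted after
  \<open>t + 1\<close> steps with \<open>gap c\<close> per nonzero digit; the right-hand side is the decay obtained after \<open>t\<close>
  steps together with the slack of \<open>binomial_le_exp\<close>. Weight 1 uses that the defect is twice as large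
  as its digit count suggests. From weight 2 on, the binomial slack \<open>w * (w - 1) / 2\<close> covers the
  missing \<open>2 * gap c * w\<close>, except for \<open>w = 2\<close> in base 2, where \<open>gap c = 1 / 2\<close> is largest and
  \<open>total_defect_base_two\<close> is needed.
\<close>
lemma total_defect_time_shift:
  assumes c: "c > 1" and m: "m \<ge> 1" and t: "t \<ge> 1"
    and ok: "\<not> (c = 2 \<and> t = 1 \<and> m \<ge> 3)" and k: "k < c ^ m" "k \<noteq> 0"
  defines "w \<equiv> balanced_weight c m k"
  shows "2 * (real t + 1) * gap c / (real m + 1) * real w \<le>
    2 * real t * total_defect c m k / (real m + 1) + real w * (real w - 1) / (2 * real m)"
proof -
  \<comment> \<open>What remains of the binomial slack after multiplying the claim by \<open>m + 1\<close>; since \<open>r \<ge> 3 / 2\<close> for \<open>m \<le> 2\<close>,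
    it also covers \<open>t = 1\<close> in base 2.\<close>
  define r where "r = (real m + 1) / real m"
  have r: "r \<ge> 1" using m by (simp add: r_def)
  have w: "w \<ge> 1" using balanced_weight_eq_0_iff[OF c k(1)] k(2) by (simp add: w_def)
  have D: "gap c * real w \<le> total_defect c m k"
    using total_defect_ge_weight[OF c k(1)] defect_nonneg[of "real k / real c ^ m"]
    by (simp add: w_def)
  have *: "2 * (real t + 1) * gap c * real w \<le>
    2 * real t * total_defect c m k + r * (real w * (real w - 1) / 2)"
  proof (cases "w = 1")
    case True
    have "2 * real t * (2 * gap c) \<le> 2 * real t * total_defect c m k"
      using total_defect_ge_two_gaps[OF c k] by (intro mult_left_mono) auto
    moreover have "1 * gap c \<le> real t * gap c"
      using t gap_pos[OF c] by (intro mult_right_mono) auto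
    ultimately show ?thesis using True by (simp add: algebra_simps)
  next
    case False
    then have w2: "w \<ge> 2" using w by simp
    have pairs: "1 * (real w * (real w - 1) / 2) \<le> r * (real w * (real w - 1) / 2)"
      using r w by (intro mult_right_mono) auto
    show ?thesis
    proof (cases "c = 2 \<and> w = 2")
      case True
      have "5 / 4 \<le> total_defect c m k"
        using total_defect_base_two[of k m] True k unfolding w_def by force
      then have "2 * real t * (5 / 4) \<le> 2 * real t * total_defect c m k"
        by (intro mult_left_mono) auto
      moreover have "2 \<le> real t / 2 + r"
      proof (cases "t = 1")
        case True
        then have "m \<le> 2" using ok \<open>c = 2 \<and> w = 2\<close> by simp
        then show ?thesis using m \<open>t = 1\<close> by (simp add: r_def field_simps)
      next
        case False
        then show ?thesis using t r by simp
      qed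
      ultimately show ?thesis using True by (simp add: gap_two algebra_simps)
    next
      case False
      have "2 * gap c * real w \<le> (real w - 1) / 2 * real w"
      proof (intro mult_right_mono)
        show "2 * gap c \<le> (real w - 1) / 2"
          using False gap_two gap_le_quarter[of c] w2 c by (cases "c = 2") auto
      qed simp
      moreover have "2 * real t * (gap c * real w) \<le> 2 * real t * total_defect c m k"
        using D by (intro mult_left_mono) auto
      moreover have "(real w - 1) / 2 * real w = 1 * (real w * (real w - 1) / 2)" by simp
      moreover have "2 * (real t + 1) * gap c * real w =
          2 * gap c * real w + 2 * real t * (gap c * real w)"
        by (simp add: algebra_simps)
      ultimately show ?thesis using pairs by linarith
    qed
  qed
  have "2 * (real t + 1) * gap c / (real m + 1) * real w =
      (2 * (real t + 1) * gap c * real w) / (real m + 1)" by simp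
  also have "\<dots> \<le> (2 * real t * total_defect c m k + r * (real w * (real w - 1) / 2)) / (real m + 1)"
    by (intro divide_right_mono *) auto
  also have "\<dots> = 2 * real t * total_defect c m k / (real m + 1) + real w * (real w - 1) / (2 * real m)"
  proof -
    have "r / (real m + 1) = 1 / real m" by (simp add: r_def)
    moreover have "r * (real w * (real w - 1) / 2) / (real m + 1) =
        real w * (real w - 1) / 2 * (r / (real m + 1))" by simp
    ultimately show ?thesis by (simp add: add_divide_distrib)
  qed
  finally show ?thesis .
qed

lemma sum_pow_fact_le_exp:
  fixes x :: real
  assumes "0 \<le> x"
  shows "(\<Sum>w\<le>m. if w = 0 then 0 else x ^ w / fact w) \<le> exp x - 1"
proof -
  have "(\<Sum>w\<le>m. x ^ w / fact w) \<le> (\<Sum>w. x ^ w /\<^sub>R fact w)"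
    using assms exp_converges[of x]
    by (intro order_trans[OF _ sum_le_suminf[of _ "{..m}"]] sum_mono) (auto simp: sums_iff field_simps)
  also have "\<dots> = exp x" by (simp add: exp_def)
  finally have "(\<Sum>w\<le>m. x ^ w / fact w) \<le> exp x" .
  moreover have "(\<Sum>w\<le>m. x ^ w / fact w) = (\<Sum>w\<le>m. if w = 0 then 0 else x ^ w / fact w) + 1"
    by (simp add: sum.atMost_shift)
  ultimately show ?thesis by simp
qed

text \<open>
  Grouping the frequencies by weight turns the left-hand side into a partial sum of the exponential
  series. The factor \<open>exp (w * (w - 1) / (2 * m))\<close> lost in \<open>total_defect_time_shift\<close> is the one gained
  in \<open>binomial_le_exp\<close>.
\<close>
lemma sum_exp_total_defect_le:
  assumes c: "c > 1" and m: "m \<ge> 1" and t: "t \<ge> 1"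
    and ok: "\<not> (c = 2 \<and> t = 1 \<and> m \<ge> 3)"
  shows "(\<Sum>k\<in>{1..<c ^ m}. exp (- (2 * real t * total_defect c m k / (real m + 1)))) \<le>
    exp (real m * (real c - 1) * exp (- (2 * (real t + 1) * gap c / (real m + 1)))) - 1"
proof -
  define p where "p = exp (- (2 * (real t + 1) * gap c / (real m + 1)))"
  define g where "g w = (if w = 0 then 0
    else p ^ w * exp (real w * (real w - 1) / (2 * real m)))" for w :: nat
  have g0: "0 \<le> g w" for w by (simp add: g_def p_def)
  have "(\<Sum>k\<in>{1..<c ^ m}. exp (- (2 * real t * total_defect c m k / (real m + 1)))) \<le>
      (\<Sum>k\<in>{1..<c ^ m}. g (balanced_weight c m k))"
  proof (rule sum_mono)
    fix k assume "k \<in> {1..<c ^ m}"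
    then have k: "k < c ^ m" "k \<noteq> 0" by auto
    let ?w = "balanced_weight c m k"
    have "p ^ ?w = exp (real ?w * (- (2 * (real t + 1) * gap c / (real m + 1))))"
      unfolding p_def by (rule exp_of_nat_mult[symmetric])
    moreover have "?w \<noteq> 0" using balanced_weight_eq_0_iff[OF c k(1)] k(2) by simp
    ultimately have "g ?w = exp (real ?w * (- (2 * (real t + 1) * gap c / (real m + 1))) +
        real ?w * (real ?w - 1) / (2 * real m))"
      by (simp only: g_def exp_add if_False)
    then show "exp (- (2 * real t * total_defect c m k / (real m + 1))) \<le> g ?w"
      using total_defect_time_shift[OF c m t ok k] by (simp add: mult.commute)
  qed
  also have "\<dots> \<le> (\<Sum>k<c ^ m. g (balanced_weight c m k))"
    using g0 by (intro sum_mono2) auto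
  also have "\<dots> = (\<Sum>w\<le>m. real (m choose w) * (real c - 1) ^ w * g w)"
    by (rule sum_over_balanced_weight[OF c])
  also have "\<dots> \<le> (\<Sum>w\<le>m. if w = 0 then 0 else (real m * (real c - 1) * p) ^ w / fact w)"
  proof (rule sum_mono)
    fix w
    define e where "e = real w * (real w - 1) / (2 * real m)"
    have "real (m choose w) * ((real c - 1) ^ w * (p ^ w * exp e)) \<le>
        real m ^ w / fact w * exp (- e) * ((real c - 1) ^ w * (p ^ w * exp e))"
      using c m binomial_le_exp[of m w]
      by (intro mult_right_mono mult_nonneg_nonneg) (auto simp: p_def e_def)
    also have "\<dots> = (real m * (real c - 1) * p) ^ w / fact w * (exp (- e) * exp e)"
      by (simp add: power_mult_distrib)
    finally show "real (m choose w) * (real c - 1) ^ w * g w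
        \<le> (if w = 0 then 0 else (real m * (real c - 1) * p) ^ w / fact w)"
      by (simp add: g_def mult.assoc e_def flip: exp_add)
  qed
  also have "\<dots> \<le> exp (real m * (real c - 1) * p) - 1"
    using c by (intro sum_pow_fact_le_exp) (auto simp: p_def)
  finally show ?thesis by (simp add: p_def)
qed

text \<open>
  At such early times the right-hand side exceeds the trivial bound on the distance. An inner
  exponent \<open>A \<ge> 2\<close> suffices, because \<open>exp 2 \<ge> 5\<close>; in the three small cases the actual value of \<open>1 / c ^ m\<close>
  enters.
\<close>
lemma trivial_tv_bound_le_exp:
  assumes c: "c > 1" and m: "m \<ge> 1"
    and cases: "t = 0 \<and> \<not> (c = 2 \<and> m = 1) \<or> t = 1 \<and> c = 2 \<and> m \<ge> 3"
  shows "4 * (1 - 1 / real c ^ m)\<^sup>2 \<le>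
    exp (real m * (real c - 1) * exp (- (2 * (real t + 1) * gap c / (real m + 1)))) - 1"
proof -
  define A where "A = real m * (real c - 1) * (1 - 2 * (real t + 1) * gap c / (real m + 1))"
  have "A \<le> real m * (real c - 1) * exp (- (2 * (real t + 1) * gap c / (real m + 1)))"
    unfolding A_def using c exp_ge_add_one_self[of "- (2 * (real t + 1) * gap c / (real m + 1))"]
    by (intro mult_left_mono) auto
  moreover have "4 * (1 - 1 / real c ^ m)\<^sup>2 \<le> exp A - 1"
  proof -
    \<comment> \<open>Halving the argument first makes the quadratic Taylor bound sharp enough.\<close>
    have double: "(1 + x + x\<^sup>2 / 2)\<^sup>2 \<le> exp A" if "0 \<le> x" "2 * x \<le> A" for x :: real
    proof -
      have "(1 + x + x\<^sup>2 / 2)\<^sup>2 \<le> (exp x)\<^sup>2"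
        using that by (intro power_mono exp_lower_Taylor_quadratic) auto
      also have "\<dots> \<le> exp A" using that by (simp flip: exp_double)
      finally show ?thesis .
    qed
    have large: "4 * (1 - 1 / real c ^ m)\<^sup>2 \<le> exp A - 1" if "2 \<le> A"
    proof -
      have "(1 - 1 / real c ^ m)\<^sup>2 \<le> 1" using c by (intro power_le_one) auto
      moreover have "exp 2 \<le> exp A" using that by simp
      moreover have "(5::real) \<le> exp 2" using exp_lower_Taylor_quadratic[of 2] by simp
      ultimately show ?thesis by linarith
    qed
    consider (two) "t = 0" "c = 2" "m = 2" | (three) "t = 0" "c = 3" "m = 1"
      | (late) "t = 1" "c = 2" "m = 3" | (late') "t = 1" "c = 2" "m \<ge> 4"
      | (wide) "t = 0" "m = 1" "c \<ge> 4" | (long) "t = 0" "m \<ge> 2" "m * (c - 1) \<ge> 3"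
    proof -
      have "m * (c - 1) \<ge> 3" if "m \<ge> 2" "\<not> (c = 2 \<and> m = 2)"
      proof (cases "c = 2")
        case False
        then have "2 * 2 \<le> m * (c - 1)" using c that by (intro mult_mono) auto
        then show ?thesis by simp
      qed (use that in auto)
      moreover have "m = 1 \<or> m \<ge> 2" "c = 2 \<or> c = 3 \<or> c \<ge> 4" using m c by auto
      ultimately show ?thesis using cases that by force
    qed
    then show ?thesis
    proof cases
      case two
      then have "2 * (2 / 3) \<le> A" by (simp add: A_def gap_two)
      with double[of "2 / 3"] two show ?thesis by (simp add: power2_eq_square)
    next
      case three
      have "2 * (3 / 4) \<le> A" using three gap_le_quarter[of 3] by (simp add: A_def)
      with double[of "3 / 4"] three show ?thesis by (simp add: power2_eq_square)
    next
      case late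
      then have "2 * (3 / 4) \<le> A" by (simp add: A_def gap_two)
      with double[of "3 / 4"] late show ?thesis by (simp add: power2_eq_square)
    next
      case late'
      then have "4 * (real m - 1) \<le> real m * (real m - 1)" by (intro mult_right_mono) auto
      then have "2 \<le> A" using late' by (simp add: A_def gap_two field_simps)
      then show ?thesis by (rule large)
    next
      case wide
      have "3 * (3 / 4) \<le> (real c - 1) * (1 - gap c)"
        using wide gap_le_quarter[of c] by (intro mult_mono) auto
      then have "2 \<le> A" using wide by (simp add: A_def)
      then show ?thesis by (rule large)
    next
      case long
      have "real 3 \<le> real (m * (c - 1))" using long by (simp only: of_nat_le_iff)
      also have "\<dots> = real m * (real c - 1)" using c by (simp add: of_nat_diff)
      finally have "3 \<le> real m * (real c - 1)" by simp
      then have "3 * (2 / 3) \<le> real m * (real c - 1) * (1 - 2 * (real t + 1) * gap c / (real m + 1))"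
      proof (intro mult_mono)
        have "2 * gap c / (real m + 1) \<le> 1 / 3"
          using long gap_le_half[OF c] by (simp add: field_simps)
        then show "2 / 3 \<le> 1 - 2 * (real t + 1) * gap c / (real m + 1)" using long by simp
      qed (use long in auto)
      then have "2 \<le> A" by (simp add: A_def)
      then show ?thesis by (rule large)
    qed
  qed
  moreover have "exp A \<le> exp y" if "A \<le> y" for y using that by simp
  ultimately show ?thesis by (meson diff_right_mono order_trans)
qed

text \<open>
  The excluded case is a genuine exception: for \<open>c = 2\<close> and \<open>m = 1\<close> the left-hand side at time 0
  is 1, whereas the right-hand side is \<open>exp (exp (- 1 / 2)) - 1 < 1\<close>.
\<close>
lemma tv_dist_geom_walk_le_next:
  assumes c: "c > 1" and m: "m \<ge> 1" and ok: "\<not> (c = 2 \<and> m = 1 \<and> t = 0)"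
  shows "4 * (tv_dist {..<c ^ m} (walk_dist (geom_seq c) (Suc m) t) (pmf_of_set {..<c ^ m}))\<^sup>2 \<le>
    exp (real m * (real c - 1) * exp (- (2 * (real t + 1) * gap c / (real m + 1)))) - 1"
proof (cases "t = 0 \<or> t = 1 \<and> c = 2 \<and> m \<ge> 3")
  case True
  let ?tv = "tv_dist {..<c ^ m} (walk_dist (geom_seq c) (Suc m) t) (pmf_of_set {..<c ^ m})"
  have "?tv \<le> 1 - 1 / real (c ^ m)"
    using set_walk_dist[of "geom_seq c" "Suc m" t] c
    by (intro tv_dist_uniform_le) (auto simp: geom_seq_def)
  moreover have "0 \<le> ?tv" by (simp add: tv_dist_def sum_nonneg)
  ultimately have "?tv\<^sup>2 \<le> (1 - 1 / real c ^ m)\<^sup>2" by (intro power_mono) auto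
  then show ?thesis using trivial_tv_bound_le_exp[OF c m, of t] True ok by auto
next
  case False
  then have "t \<ge> 1" "\<not> (c = 2 \<and> t = 1 \<and> m \<ge> 3)" by auto
  from sum_exp_total_defect_le[OF c m this] tv_dist_geom_walk_le[OF c] show ?thesis
    by (rule order_trans[rotated])
qed

section \<open>The mixing time\<close>

theorem theorem4p1:
  fixes c n :: nat and \<epsilon> \<kappa> :: real
  assumes "c > 1" and "n \<ge> 2" and "\<epsilon> > 0"
    and "\<kappa> = 1 / (1 - cos (pi / real c))"
    and "ln (4 * \<epsilon>\<^sup>2 + 1) \<le> (real n - 1) * (real c - 1)"
    and "\<not> (n = 2 \<and> c = 2 \<and> exp (- 1 / 2) < ln (4 * \<epsilon>\<^sup>2 + 1) \<and> \<epsilon> < 1 / 2)"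
  shows "real (t_mix (geom_seq c) n \<epsilon>)
    \<le> \<kappa> * real n * ln ((real n - 1) * (real c - 1))
      - \<kappa> * real n * ln (ln (4 * \<epsilon>\<^sup>2 + 1))"
proof -
  define m where "m = n - 1"
  have n: "n = Suc m" and m: "m \<ge> 1" using assms(2) by (auto simp: m_def)
  define L where "L = ln (4 * \<epsilon>\<^sup>2 + 1)"
  define B where "B = (real n - 1) * (real c - 1)"
  define T where "T = \<kappa> * real n * ln B - \<kappa> * real n * ln L"
  define t where "t = nat \<lfloor>T\<rfloor>"
  let ?tv = "tv_dist {..<geom_seq c n} (walk_dist (geom_seq c) n t) (pmf_of_set {..<geom_seq c n})"
  have L: "0 < L" using assms(3) unfolding L_def by (intro ln_gt_zero) simp
  have B: "0 < B" using assms(1,2) by (simp add: B_def)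
  have N: "geom_seq c n = c ^ m" by (simp add: n geom_seq_def)
  have \<kappa>: "\<kappa> = 1 / (2 * gap c)" by (simp add: assms(4) gap_eq)
  have gap: "0 < gap c" by (rule gap_pos[OF assms(1)])
  have T: "T = \<kappa> * real n * ln (B / L)"
    using L B by (simp add: T_def ln_div algebra_simps)
  have "0 \<le> ln (B / L)" using assms(5) L B by (simp add: L_def B_def)
  then have "0 \<le> T" unfolding T \<kappa> using gap by simp
  then have t: "real t \<le> T" "T < real t + 1" unfolding t_def by linarith+
  have "ln (B / L) < 2 * (real t + 1) * gap c / real n"
    using t(2) gap assms(2) by (simp add: T \<kappa> field_simps)
  then have "B / L < exp (2 * (real t + 1) * gap c / real n)"
    using B L by (metis divide_pos_pos exp_less_cancel_iff exp_ln)
  then have next_L: "B * exp (- (2 * (real t + 1) * gap c / real n)) < L"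
    using L by (simp add: exp_minus field_simps)
  have "?tv \<le> \<epsilon>"
  proof (cases "c = 2 \<and> m = 1 \<and> t = 0")
    case True
    \<comment> \<open>The walk on two points is at distance \<open>1 / 2\<close> at time 0, and \<open>T < 1\<close> means \<open>L > exp (- 1 / 2)\<close>.\<close>
    then have "exp (- 1 / 2) < L" using next_L by (simp add: B_def n gap_two)
    then have "1 / 2 \<le> \<epsilon>" using assms(6) True by (auto simp: n L_def)
    moreover have "?tv \<le> 1 - 1 / real (geom_seq c n)"
      using set_walk_dist[of "geom_seq c" n t] assms(1)
      by (intro tv_dist_uniform_le) (auto simp: N)
    moreover have "1 - 1 / real (geom_seq c n) = 1 / 2" using True N by simp
    ultimately show ?thesis by linarith
  next
    case False
    have "4 * ?tv\<^sup>2 \<le> exp (B * exp (- (2 * (real t + 1) * gap c / real n))) - 1"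
      using tv_dist_geom_walk_le_next[OF assms(1) m, of t] False unfolding N
      by (simp add: n B_def add.commute)
    also have "\<dots> \<le> exp L - 1" using next_L by simp
    also have "\<dots> = 4 * \<epsilon>\<^sup>2" by (simp add: L_def add_nonneg_pos)
    finally have "?tv\<^sup>2 \<le> \<epsilon>\<^sup>2" by simp
    then show ?thesis using assms(3) by (auto intro: power2_le_imp_le)
  qed
  then have "t_mix (geom_seq c) n \<epsilon> \<le> t" unfolding t_mix_def by (rule Least_le)
  then have "real (t_mix (geom_seq c) n \<epsilon>) \<le> T" using t(1) by linarith
  then show ?thesis by (simp add: T_def B_def L_def)
qed

end
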